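(* Let $\gamma\in\mathbb{R}$ and let $\{\pi_1,\dots,\pi_\ell\}$ be a finite partition of $\mathbb{N}$. Let $\psi:\mathbb{N}\to\mathbb{R}_{\geq 0}$ be decreasing with $\sum_{q=1}^\infty\psi(q)=\infty$. Then there exists a partition element $\pi\in\{\pi_1,\dots,\pi_\ell\}$ such that $\mathrm{m}(W(\mathbf{1}_{\pi}\psi,\gamma))=1$.
   Context: $\mathbb{N}=\{1,2,3,\dots\}$. "Decreasing" means $\psi(q+1)\leq\psi(q)$ for all $q$. $\|x\|$ denotes the distance from $x\in\mathbb{R}$ to the nearest integer, $\mathrm{m}$ is Lebesgue measure, and $\mathbf{1}_{\pi}$ is the indicator function of $\pi\subset\mathbb{N}$ (so $\mathbf{1}_\pi\psi$ is the pointwise product). For $\psi:\mathbb{N}\to\mathbb{R}_{\geq 0}$ (not necessarily monotone) and a real number $\gamma$, $$W(\psi,\gamma)=\{\alpha\in[0,1] : \|q\alpha-\gamma\|<\psi(q)\text{ for infinitely many } q\in\mathbb{N}\}.$$ *)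

theory Defs
  imports "HOL-Analysis.Analysis"
begin

definition nearest_int_dist :: "real \<Rightarrow> real" where
  "nearest_int_dist x = dist x (of_int (round x))"

(* The positive integers are the set {1..} of type nat, so the value of psi at 0 is irrelevant. *)
definition W :: "(nat \<Rightarrow> real) \<Rightarrow> real \<Rightarrow> real set" where
  "W \<psi> \<gamma> =
    {\<alpha> \<in> {0..1}. infinite {q \<in> {1..}. nearest_int_dist (real q * \<alpha> - \<gamma>) < \<psi> q}}"

end

(* By pigeonhole and Cauchy condensation, some class \<pi> contains a fixed proportion of the dyadic block
   [N, 2N), N = 2^k, for enough k that the weights c_k = min 1 (N \<psi>(2N) / 2) of these k still have
   a divergent sum.  Consider the points (a + \<gamma>) / q with q in such a block of \<pi>.  Discard a point if
   it lies within O(1/(sN)) of a reduced m/s with s at most a small multiple of N: such points have q in a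
   single residue class mod s, so at most 2N/s of them are near m/s, and only a small proportion
   is lost in every fixed interval.  The remaining points are spread out: boundedly many lie in any
   interval of length 1/N^2.  Hence the balls of radius c_k / N^2 around them are quasi-independent
   on average inside every interval, and their limsup set fills a fixed proportion of
   every interval; so does W, which must then have full measure. *)
theory Submission
  imports Defs
begin

subsection \<open>Measure theory\<close>

text \<open>Second-moment lower bound for a union. The parameter t stays free, so nothing is divided
  by a second moment; \<open>measure_UN_balls_ge\<close> picks t.\<close>

lemma measure_UN_ge_pairwise:
  fixes A :: "'i \<Rightarrow> 'a set" and t :: real
  assumes "finite I" and A: "\<And>i. i \<in> I \<Longrightarrow> A i \<in> fmeasurable M"
  shows "2 * t * (\<Sum>i\<in>I. measure M (A i)) - t\<^sup>2 * (\<Sum>i\<in>I. \<Sum>j\<in>I. measure M (A i \<inter> A j))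
      \<le> measure M (\<Union>i\<in>I. A i)"
proof -
  define U where "U = (\<Union>i\<in>I. A i)"
  have U: "U \<in> fmeasurable M"
    unfolding U_def using assms by (intro fmeasurable.finite_UN) auto
  define X where "X x = (\<Sum>i\<in>I. indicator (A i) x :: real)" for x
  have X2: "(X x)\<^sup>2 = (\<Sum>i\<in>I. \<Sum>j\<in>I. indicator (A i \<inter> A j) x)" for x
    by (simp add: X_def power2_eq_square sum_product indicator_inter_arith)
  have AA: "A i \<inter> A j \<in> fmeasurable M" if "i \<in> I" "j \<in> I" for i j
    using A that by auto
  (* On U this is 0 <= (1 - t X)^2; optimising over t would give the Chung-Erdos inequality. *)
  have le: "2 * t * X x - t\<^sup>2 * (X x)\<^sup>2 \<le> indicator U x" for x
  proof (cases "x \<in> U")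
    case True
    have "0 \<le> (1 - t * X x)\<^sup>2" by simp
    with True show ?thesis by (simp add: power2_eq_square algebra_simps)
  next
    case False
    then have "X x = 0" by (auto simp: X_def U_def)
    with False show ?thesis by simp
  qed
  have "integral\<^sup>L M (\<lambda>x. 2 * t * X x - t\<^sup>2 * (X x)\<^sup>2) \<le> integral\<^sup>L M (\<lambda>x. indicator U x)"
    using A AA U le unfolding X2 unfolding X_def
    by (intro integral_mono) (auto simp: fmeasurable_def less_top)
  also have "integral\<^sup>L M (\<lambda>x. 2 * t * X x - t\<^sup>2 * (X x)\<^sup>2)
      = 2 * t * (\<Sum>i\<in>I. measure M (A i)) - t\<^sup>2 * (\<Sum>i\<in>I. \<Sum>j\<in>I. measure M (A i \<inter> A j))"
    using A AA unfolding X2 unfolding X_def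
    by (subst Bochner_Integration.integral_diff)
       (auto simp: fmeasurable_def less_top Bochner_Integration.integral_sum
          intro!: arg_cong2[where f="(-)"] arg_cong2[where f="(*)"] sum.cong)
  finally show ?thesis using U by (simp add: U_def fmeasurable_def)
qed

section \<open>Full measure from a uniform local proportion\<close>

text \<open>A density argument by contradiction. If the complement V had positive measure, an open U
  around V with \<open>U - V\<close> of measure below \<kappa> m(V) would contain non-overlapping
  intervals covering V. W takes a proportion \<kappa> of each, and these pieces of W lie in
  \<open>U - V\<close>, which is too small for them.\<close>

lemma emeasure_eq_1_of_locally_positive:
  fixes W :: "real set"
  assumes W: "W \<in> sets lebesgue" "W \<subseteq> {0..1}" and "\<kappa> > 0"
    and dens: "\<And>u v. \<lbrakk>0 \<le> u; u < v; v \<le> 1\<rbrakk> \<Longrightarrow> \<kappa> * (v - u) \<le> measure lebesgue (W \<inter> {u..v})"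
  shows "emeasure lebesgue W = 1"
proof -
  define V where "V = {0..1} - W"
  have Vs: "V \<in> sets lebesgue" unfolding V_def using W by (intro sets.Diff) auto
  have "emeasure lebesgue V = 0"
  proof (rule ccontr)
    assume V0: "emeasure lebesgue V \<noteq> 0"
    have "emeasure lebesgue V \<le> emeasure lebesgue {0..1::real}"
      by (rule emeasure_mono) (auto simp: V_def)
    then have fin: "emeasure lebesgue V \<noteq> \<infinity>"
      by (auto simp: top_unique)
    with V0 have "measure lebesgue V \<noteq> 0"
      using emeasure_eq_ennreal_measure[of lebesgue V] by auto
    with \<open>\<kappa> > 0\<close> have "0 < \<kappa> * measure lebesgue V"
      by (simp add: zero_less_measure_iff)
    then obtain U where U: "open U" "V \<subseteq> U" "U - V \<in> lmeasurable"
      "emeasure lebesgue (U - V) < ennreal (\<kappa> * measure lebesgue V)"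
      using sets_lebesgue_outer_open[OF Vs] by metis
    \<comment> \<open>The gauge keeps every interval tagged at a point of V inside U;
      \<open>UNIV\<close> is the default off U.\<close>
    define g where "g x = (if x \<in> U then U else UNIV)" for x
    have g: "gauge g" using U(1) by (auto simp: gauge_def g_def)
    have V01: "V \<subseteq> cbox 0 1" by (auto simp: V_def)
    have box01: "box 0 (1::real) \<noteq> {}" by simp
    obtain D where D: "countable D" "\<Union>D \<subseteq> cbox 0 (1::real)"
      "\<And>K. K \<in> D \<Longrightarrow> interior K \<noteq> {} \<and> (\<exists>c d. K = cbox c d)"
      "pairwise (\<lambda>A B. interior A \<inter> interior B = {}) D"
      "\<And>K. K \<in> D \<Longrightarrow> \<exists>x\<in>V \<inter> K. K \<subseteq> g x"
      "V \<subseteq> \<Union>D"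
      by (rule covering_lemma[OF V01 box01 g]) (rule that; assumption)
    have DU: "K \<subseteq> U" if "K \<in> D" for K
      using D(5)[OF that] U(2) by (auto simp: g_def split: if_splits)
    \<comment> \<open>Intervals of \<open>D\<close> may share endpoints. Their interiors are
      disjoint, and the endpoints dropped form a countable, hence null, set.\<close>
    define O' where "O' = (\<Union>K\<in>D. interior K)"
    have disj: "disjoint_family_on interior D"
      using D(4) by (auto simp: disjoint_family_on_def pairwise_def)
    have "open O'" by (auto simp: O'_def)
    then have Os: "O' \<in> sets lebesgue" by simp
    have D_int: "countable (K - interior K)" if K: "K \<in> D" for K
    proof -
      obtain c d where "K = {c..d}" using D(3)[OF K] by auto
      then have "K - interior K \<subseteq> {c, d}" by auto
      then show ?thesis by (rule countable_subset) simp
    qed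
    have "countable (\<Union>K\<in>D. K - interior K)" using D(1) D_int by (intro countable_UN) auto
    then have null: "(\<Union>K\<in>D. K - interior K) \<in> null_sets lebesgue"
      using countable_imp_null_set_lborel null_sets_completionI by blast
    have "emeasure lebesgue V \<le> emeasure lebesgue (O' \<union> (\<Union>K\<in>D. K - interior K))"
      using D(6) Os null by (intro emeasure_mono) (auto simp: O'_def)
    also have "\<dots> = emeasure lebesgue O'"
      by (rule emeasure_Un_null_set[OF Os null])
    finally have VO: "emeasure lebesgue V \<le> emeasure lebesgue O'" .
    have Wint: "W \<inter> interior K \<in> sets lebesgue" for K
      by (intro sets.Int W(1)) simp
    have K: "ennreal \<kappa> * emeasure lebesgue (interior K) \<le> emeasure lebesgue (W \<inter> interior K)" if K: "K \<in> D" for K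
    proof -
      obtain c d where cd: "K = {c..d}" using D(3)[OF K] by auto
      with D(3)[OF K] have "c < d" by auto
      moreover have "0 \<le> c" "d \<le> 1"
      proof -
        have "{c..d} \<subseteq> cbox 0 1" using order_trans[OF Union_upper[OF K] D(2)] unfolding cd .
        then show "0 \<le> c" "d \<le> 1" using \<open>c < d\<close> by auto
      qed
      ultimately have d: "\<kappa> * (d - c) \<le> measure lebesgue (W \<inter> {c..d})" using dens by auto
      have fm: "W \<inter> {c..d} \<in> lmeasurable"
        using W by (intro bounded_set_imp_lmeasurable) (auto intro: bounded_subset[of "{c..d}"])
      have null_cd: "{c, d} \<in> null_sets lebesgue"
        by (intro null_sets_completionI countable_imp_null_set_lborel) simp
      have "ennreal \<kappa> * emeasure lebesgue (interior K) = ennreal (\<kappa> * (d - c))"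
        using \<open>c < d\<close> \<open>\<kappa> > 0\<close> cd by (simp add: ennreal_mult'')
      also have "\<dots> \<le> ennreal (measure lebesgue (W \<inter> {c..d}))" using d by (rule ennreal_leI)
      also have "\<dots> = emeasure lebesgue (W \<inter> {c..d})" using fm by (simp add: emeasure_eq_measure2)
      also have "\<dots> \<le> emeasure lebesgue ((W \<inter> interior K) \<union> {c,d})"
        using Wint[of K] null_cd cd by (intro emeasure_mono sets.Un) auto
      also have "\<dots> = emeasure lebesgue (W \<inter> interior K)"
        by (rule emeasure_Un_null_set[OF Wint null_cd])
      finally show ?thesis .
    qed
    have "ennreal \<kappa> * emeasure lebesgue V \<le> ennreal \<kappa> * emeasure lebesgue O'"
      by (rule mult_left_mono[OF VO]) simp
    also have "\<dots> = (\<integral>\<^sup>+K. ennreal \<kappa> * emeasure lebesgue (interior K) \<partial>count_space D)"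
      unfolding O'_def using D(1) disj by (subst emeasure_UN_countable) (auto simp: nn_integral_cmult)
    also have "\<dots> \<le> (\<integral>\<^sup>+K. emeasure lebesgue (W \<inter> interior K) \<partial>count_space D)"
      using K by (intro nn_integral_mono) auto
    also have "\<dots> = emeasure lebesgue (\<Union>K\<in>D. W \<inter> interior K)"
      using D(1) disj Wint by (subst emeasure_UN_countable) (auto simp: disjoint_family_on_def)
    also have "\<dots> \<le> emeasure lebesgue (U - V)"
    proof (rule emeasure_mono)
      have "interior K \<subseteq> U" if "K \<in> D" for K using DU[OF that] interior_subset[of K] by blast
      then show "(\<Union>K\<in>D. W \<inter> interior K) \<subseteq> U - V" unfolding V_def by blast
      show "U - V \<in> sets lebesgue" using U(3) by (rule fmeasurableD)
    qed
    also have "\<dots> < ennreal (\<kappa> * measure lebesgue V)" by (rule U)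
    also have "\<dots> = ennreal \<kappa> * emeasure lebesgue V"
      unfolding emeasure_eq_ennreal_measure[OF fin[unfolded infinity_ennreal_def]]
      by (rule ennreal_mult'') simp
    finally show False by simp
  qed
  then have null: "V \<in> null_sets lebesgue" using Vs by (rule null_setsI)
  have "emeasure lebesgue W = emeasure lebesgue (W \<union> V)"
    using emeasure_Un_null_set[OF W(1) null] by simp
  also have "W \<union> V = {0..1}" using W by (auto simp: V_def)
  finally show ?thesis by simp
qed


section \<open>Second moment of balls at scales 4^-k\<close>

lemma sum_pow4_le:
  fixes k :: nat
  assumes "finite F"
  shows "(\<Sum>j\<in>F. if j \<le> k then (4::real) ^ j / 4 ^ k else 0) \<le> 2"
proof -
  have "(\<Sum>j\<in>F. if j \<le> k then (4::real) ^ j / 4 ^ k else 0) = (\<Sum>j\<in>F \<inter> {..k}. 4 ^ j / 4 ^ k)"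
    using assms by (simp add: sum.inter_restrict)
  also have "\<dots> \<le> (\<Sum>j\<in>{..k}. 4 ^ j / 4 ^ k)" by (intro sum_mono2) auto
  also have "\<dots> = (\<Sum>j\<le>k. (4::real) ^ j) / 4 ^ k" by (simp add: sum_divide_distrib)
  also have "(\<Sum>j\<le>k. (4::real) ^ j) = (4 ^ Suc k - 1) / 3" by (induction k) auto
  also have "(4 ^ Suc k - 1) / 3 / 4 ^ k \<le> (2 :: real)" by (simp add: field_simps)
  finally show ?thesis .
qed

lemma measure_ball_Int_le:
  fixes x y r s :: real
  assumes "0 \<le> r"
  shows "measure lebesgue (ball x r \<inter> ball y s) \<le> (if \<bar>x - y\<bar> < r + s then 2 * r else 0)"
proof (cases "\<bar>x - y\<bar> < r + s")
  case True
  have "measure lebesgue (ball x r \<inter> ball y s) \<le> measure lebesgue (ball x r)"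
    by (intro measure_mono_fmeasurable) auto
  also have "\<dots> = 2 * r" using assms by (simp add: ball_eq_greaterThanLessThan)
  finally show ?thesis using True by simp
next
  case False
  then have "ball x r \<inter> ball y s = {}"
    by (intro disjoint_ballI) (simp add: dist_real_def)
  then show ?thesis using False by simp
qed

text \<open>All balls, over all \<^term>\<open>k\<close> and \<^term>\<open>p\<close>, are treated as separate events, so no disjointness within
  a level \<^term>\<open>k\<close> is needed.\<close>

lemma measure_UN_balls_ge:
  fixes P :: "nat \<Rightarrow> 'i set" and x :: "'i \<Rightarrow> real" and c :: "nat \<Rightarrow> real"
    and \<kappa> \<Lambda> M L :: real
  assumes pos: "\<kappa> > 0" "\<Lambda> > 0" "M > 0" "L > 0"
    and F: "finite F"
    and P: "\<And>k. k \<in> F \<Longrightarrow> finite (P k)"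
    and c: "\<And>k. k \<in> F \<Longrightarrow> 0 \<le> c k" "\<And>k. k \<in> F \<Longrightarrow> c k \<le> 1"
    and lower: "\<And>k. k \<in> F \<Longrightarrow> c k > 0 \<Longrightarrow> \<kappa> * 4 ^ k * L \<le> card (P k)"
    and upper: "\<And>k. k \<in> F \<Longrightarrow> card (P k) \<le> \<Lambda> * 4 ^ k * L"
    and spread: "\<And>k t h. \<lbrakk>k \<in> F; h \<ge> 0\<rbrakk> \<Longrightarrow> card {p \<in> P k. \<bar>x p - t\<bar> < h} \<le> M * (h * 4 ^ k + 1)"
    and sum1: "1 \<le> (\<Sum>k\<in>F. c k)"
  shows "\<kappa>\<^sup>2 / (9 * \<Lambda> * M) * L \<le> measure lebesgue (\<Union>k\<in>F. \<Union>p\<in>P k. ball (x p) (c k / 4 ^ k))"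
proof -
  define S where "S = (\<Sum>k\<in>F. c k)"
  define r where "r k = c k / 4 ^ k" for k
  define J where "J = Sigma F P"
  define B where "B i = ball (x (snd i)) (r (fst i))" for i :: "nat \<times> 'i"
  define C where "C = 2 * \<Lambda> * M * L"
  have r0: "0 \<le> r k" if "k \<in> F" for k using c that by (simp add: r_def)
  have r1: "r k * 4 ^ k = c k" for k by (simp add: r_def)
  have C0: "C > 0" using pos by (simp add: C_def)
  define D where "D k j = (\<Sum>p\<in>P k. \<Sum>p'\<in>P j. measure lebesgue (ball (x p) (r k) \<inter> ball (x p') (r j)))" for k j
  \<comment> \<open>For j \<le> k, at most \<open>M * ((r k + r j) * 4 ^ k + 1)\<close> balls of
    level k meet a given ball of level j, and each overlap is at most \<open>2 * r k\<close>. The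
    product \<open>c j * c k\<close> is the independent part; the error decays like 4^(j -
    k).\<close>
  have D: "D k j \<le> C * (c j * c k + 2 * (4 ^ j / 4 ^ k) * c k)" if "k \<in> F" "j \<in> F" "j \<le> k" for k j
  proof -
    have "D k j = (\<Sum>p'\<in>P j. \<Sum>p\<in>P k. measure lebesgue (ball (x p) (r k) \<inter> ball (x p') (r j)))"
      unfolding D_def by (rule sum.swap)
    also have "\<dots> \<le> (\<Sum>p'\<in>P j. M * ((r k + r j) * 4 ^ k + 1) * (2 * r k))"
    proof (rule sum_mono)
      fix p' assume "p' \<in> P j"
      have "(\<Sum>p\<in>P k. measure lebesgue (ball (x p) (r k) \<inter> ball (x p') (r j)))
         \<le> (\<Sum>p\<in>P k. if \<bar>x p - x p'\<bar> < r k + r j then 2 * r k else 0)"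
        using r0 that by (intro sum_mono measure_ball_Int_le) auto
      also have "\<dots> = card {p \<in> P k. \<bar>x p - x p'\<bar> < r k + r j} * (2 * r k)"
        using P[OF that(1)] by (simp add: sum.inter_filter [symmetric])
      also have "\<dots> \<le> M * ((r k + r j) * 4 ^ k + 1) * (2 * r k)"
        using r0 that by (intro mult_right_mono spread) auto
      finally show "(\<Sum>p\<in>P k. measure lebesgue (ball (x p) (r k) \<inter> ball (x p') (r j)))
         \<le> M * ((r k + r j) * 4 ^ k + 1) * (2 * r k)" .
    qed
    also have "\<dots> = card (P j) * (M * ((r k + r j) * 4 ^ k + 1) * (2 * r k))" by simp
    also have "\<dots> \<le> (\<Lambda> * 4 ^ j * L) * (M * ((r k + r j) * 4 ^ k + 1) * (2 * r k))"
      using upper[OF that(2)] r0 that pos by (intro mult_right_mono mult_nonneg_nonneg) auto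
    also have "\<dots> = C * (c j * c k + (c k + 1) * (4 ^ j / 4 ^ k) * c k)"
      by (simp add: C_def r_def field_simps)
    also have "\<dots> \<le> C * (c j * c k + 2 * (4 ^ j / 4 ^ k) * c k)"
      using c that C0 by (intro mult_left_mono add_mono mult_right_mono) auto
    finally show ?thesis .
  qed
  have Dsym: "D k j = D j k" for k j
    unfolding D_def by (subst sum.swap) (simp add: Int_commute)
  define e where "e k j = (if j \<le> k then (4::real) ^ j / 4 ^ k else 0)" for k j :: nat
  \<comment> \<open>Adding the error terms of both orders gives one bound for all pairs: the term
    belonging to the other order is nonnegative.\<close>
  have D': "D k j \<le> C * (c j * c k) + 2 * C * (e k j * c k) + 2 * C * (e j k * c j)" if "k \<in> F" "j \<in> F" for k j
  proof (cases "j \<le> k")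
    case True
    have "0 \<le> 2 * C * (e j k * c j)" using C0 c that by (auto simp: e_def)
    then show ?thesis using D[OF that True] True by (simp add: e_def algebra_simps)
  next
    case False
    then have "0 \<le> 2 * C * (e k j * c k)" using C0 c that by (auto simp: e_def)
    then show ?thesis using D[OF that(2,1)] False unfolding Dsym[of k j] by (simp add: e_def algebra_simps)
  qed
  have e2: "(\<Sum>j\<in>F. e k j) \<le> 2" for k unfolding e_def by (rule sum_pow4_le[OF F])
  have ce: "(\<Sum>k\<in>F. \<Sum>j\<in>F. e k j * c k) \<le> 2 * S"
  proof -
    have "(\<Sum>k\<in>F. \<Sum>j\<in>F. e k j * c k) = (\<Sum>k\<in>F. (\<Sum>j\<in>F. e k j) * c k)" by (simp add: sum_distrib_right)
    also have "\<dots> \<le> (\<Sum>k\<in>F. 2 * c k)" using c e2 by (intro sum_mono mult_right_mono) auto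
    finally show ?thesis by (simp add: S_def sum_distrib_left)
  qed
  have "(\<Sum>k\<in>F. \<Sum>j\<in>F. D k j)
     \<le> (\<Sum>k\<in>F. \<Sum>j\<in>F. C * (c j * c k) + 2 * C * (e k j * c k) + 2 * C * (e j k * c j))"
    using D' by (intro sum_mono) auto
  also have "\<dots> = C * (\<Sum>k\<in>F. \<Sum>j\<in>F. c j * c k) + 2 * C * (\<Sum>k\<in>F. \<Sum>j\<in>F. e k j * c k)
     + 2 * C * (\<Sum>k\<in>F. \<Sum>j\<in>F. e j k * c j)"
    by (simp add: sum.distrib sum_distrib_left)
  also have "(\<Sum>k\<in>F. \<Sum>j\<in>F. e j k * c j) = (\<Sum>k\<in>F. \<Sum>j\<in>F. e k j * c k)" by (rule sum.swap)
  also have "(\<Sum>k\<in>F. \<Sum>j\<in>F. c j * c k) = S\<^sup>2"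
    unfolding S_def power2_eq_square sum_product by (simp add: mult.commute)
  also have "C * S\<^sup>2 + 2 * C * (\<Sum>k\<in>F. \<Sum>j\<in>F. e k j * c k) + 2 * C * (\<Sum>k\<in>F. \<Sum>j\<in>F. e k j * c k)
     \<le> C * S\<^sup>2 + 2 * C * (2 * S) + 2 * C * (2 * S)"
    using ce C0 by (intro add_mono mult_left_mono) auto
  \<comment> \<open>Since \<open>S \<ge> 1\<close>, the linear terms \<open>8 * C * S\<close> are
    absorbed into the quadratic one.\<close>
  also have "\<dots> \<le> 9 * C * S\<^sup>2"
  proof -
    have "S * 1 \<le> S * S" using sum1 by (intro mult_left_mono) (auto simp: S_def)
    then have "C * S \<le> C * S\<^sup>2" using C0 by (simp add: power2_eq_square)
    then show ?thesis by simp
  qed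
  finally have DS: "(\<Sum>k\<in>F. \<Sum>j\<in>F. D k j) \<le> 9 * C * S\<^sup>2" .
  have J: "finite J" using F P by (simp add: J_def)
  have sumJ: "(\<Sum>i\<in>J. G i) = (\<Sum>k\<in>F. \<Sum>p\<in>P k. G (k, p))" for G :: "nat \<times> 'i \<Rightarrow> real"
    unfolding J_def using F P by (simp add: sum.Sigma)
  have second: "(\<Sum>i\<in>J. \<Sum>j\<in>J. measure lebesgue (B i \<inter> B j)) = (\<Sum>k\<in>F. \<Sum>j\<in>F. D k j)"
  proof -
    have "(\<Sum>i\<in>J. \<Sum>j\<in>J. measure lebesgue (B i \<inter> B j))
       = (\<Sum>k\<in>F. \<Sum>p\<in>P k. \<Sum>j\<in>F. \<Sum>p'\<in>P j. measure lebesgue (ball (x p) (r k) \<inter> ball (x p') (r j)))"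
      unfolding sumJ by (simp add: B_def)
    also have "\<dots> = (\<Sum>k\<in>F. \<Sum>j\<in>F. D k j)"
      unfolding D_def by (intro sum.cong refl sum.swap)
    finally show ?thesis .
  qed
  have "2 * \<kappa> * L * S = (\<Sum>k\<in>F. 2 * \<kappa> * L * c k)" by (simp add: S_def sum_distrib_left)
  also have "\<dots> \<le> (\<Sum>k\<in>F. card (P k) * (2 * r k))"
  proof (rule sum_mono)
    fix k assume k: "k \<in> F"
    \<comment> \<open>Where \<open>c k = 0\<close> there is no lower bound on
      \<open>card (P k)\<close>, but both sides vanish.\<close>
    show "2 * \<kappa> * L * c k \<le> card (P k) * (2 * r k)"
    proof (cases "c k > 0")
      case True
      have "2 * \<kappa> * L * c k = (\<kappa> * 4 ^ k * L) * (2 * r k)" by (simp add: r_def)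
      also have "\<dots> \<le> card (P k) * (2 * r k)"
        using lower[OF k True] r0[OF k] by (intro mult_right_mono) auto
      finally show ?thesis .
    next
      case False
      then have "c k = 0" using c(1)[OF k] by simp
      then show ?thesis by (simp add: r_def)
    qed
  qed
  also have "\<dots> = (\<Sum>k\<in>F. \<Sum>p\<in>P k. measure lebesgue (ball (x p) (r k)))"
    using r0 by (intro sum.cong) (simp_all add: ball_eq_greaterThanLessThan)
  also have "\<dots> = (\<Sum>i\<in>J. measure lebesgue (B i))"
    unfolding sumJ by (simp add: B_def)
  finally have first: "2 * \<kappa> * L * S \<le> (\<Sum>i\<in>J. measure lebesgue (B i))" .
  \<comment> \<open>With first moment at least \<open>2 * \<kappa> * L * S\<close> and second moment
    at most \<open>9 * C * S\<^sup>2\<close>, the bound in terms of \<open>\<tau> = t * S\<close> is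
    \<open>4 * \<kappa> * L * \<tau> - 18 * \<Lambda> * M * L * \<tau>\<^sup>2\<close>. It is
    maximal at this \<tau>, where it is twice the claim.\<close>
  define \<tau> where "\<tau> = \<kappa> / (9 * \<Lambda> * M)"
  define t where "t = \<tau> / S"
  have S1: "S \<ge> 1" using sum1 by (simp add: S_def)
  have \<tau>: "\<tau> > 0" "\<tau> * (9 * \<Lambda> * M) = \<kappa>" using pos by (simp_all add: \<tau>_def)
  then have t0: "t \<ge> 0" and tS: "t * S = \<tau>" using S1 by (simp_all add: t_def)
  have "2 * t * (2 * \<kappa> * L * S) - t\<^sup>2 * (9 * C * S\<^sup>2) = 4 * \<kappa> * L * (t * S) - 9 * C * (t * S)\<^sup>2"
    by (simp add: power2_eq_square mult_ac)
  also have "\<dots> = 4 * \<kappa> * L * \<tau> - 2 * L * \<tau> * (\<tau> * (9 * \<Lambda> * M))"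
    unfolding tS C_def power2_eq_square by (simp only: mult_ac)
  also have "\<dots> = 2 * (\<kappa> * \<tau> * L)" unfolding \<tau>(2) by simp
  finally have val: "2 * t * (2 * \<kappa> * L * S) - t\<^sup>2 * (9 * C * S\<^sup>2) = 2 * (\<kappa> * \<tau> * L)" .
  have "0 < \<kappa> * \<tau> * L" using pos \<tau> by simp
  moreover have "\<kappa>\<^sup>2 / (9 * \<Lambda> * M) * L = \<kappa> * \<tau> * L" by (simp add: \<tau>_def power2_eq_square)
  ultimately have "\<kappa>\<^sup>2 / (9 * \<Lambda> * M) * L \<le> 2 * t * (2 * \<kappa> * L * S) - t\<^sup>2 * (9 * C * S\<^sup>2)"
    unfolding val by linarith
  also have "\<dots> \<le> 2 * t * (\<Sum>i\<in>J. measure lebesgue (B i)) - t\<^sup>2 * (\<Sum>i\<in>J. \<Sum>j\<in>J. measure lebesgue (B i \<inter> B j))"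
    unfolding second using first DS t0 by (intro diff_mono mult_left_mono) auto
  also have "\<dots> \<le> measure lebesgue (\<Union>i\<in>J. B i)"
    using J by (intro measure_UN_ge_pairwise) (auto simp: B_def)
  also have "(\<Union>i\<in>J. B i) = (\<Union>k\<in>F. \<Union>p\<in>P k. ball (x p) (c k / 4 ^ k))"
    unfolding J_def B_def r_def by force
  finally show ?thesis .
qed

subsection \<open>Shifted fractions with denominators in a dyadic block\<close>

lemma ints_in_interval_eq: "{a::int. x \<le> of_int a \<and> of_int a \<le> y} = {\<lceil>x::real\<rceil>..\<lfloor>y\<rfloor>}"
  by (auto simp: ceiling_le_iff le_floor_iff)

lemma card_ints_in_interval_ge:
  fixes x y :: real
  shows "y - x - 1 \<le> card {a::int. x \<le> of_int a \<and> of_int a \<le> y}"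
proof -
  have "y - x - 1 \<le> of_int (\<lfloor>y\<rfloor> - \<lceil>x\<rceil> + 1)" by linarith
  also have "\<dots> \<le> real (nat (\<lfloor>y\<rfloor> - \<lceil>x\<rceil> + 1))" by linarith
  finally show ?thesis by (simp add: ints_in_interval_eq add.commute)
qed

lemma card_ints_in_interval_le:
  fixes x y :: real
  assumes "x \<le> y"
  shows "card {a::int. x \<le> of_int a \<and> of_int a \<le> y} \<le> y - x + 1"
proof -
  have "real (nat (\<lfloor>y\<rfloor> - \<lceil>x\<rceil> + 1)) \<le> y - x + 1" using assms by linarith
  then show ?thesis by (simp add: ints_in_interval_eq add.commute)
qed

text \<open>These are the centres of the balls that make up W: for p = (q, a), |q \<alpha> -
  \<gamma> - a| is q times the distance from \<alpha> to
  \<open>shifted_frac \<gamma> p\<close>.\<close>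

definition shifted_frac :: "real \<Rightarrow> nat \<times> int \<Rightarrow> real" where
  "shifted_frac \<gamma> p = (of_int (snd p) + \<gamma>) / real (fst p)"

text \<open>Pairs, not reals: coinciding fractions with different denominators are counted
  separately, so the count splits into integers in an interval for each q.\<close>

definition frac_set :: "real \<Rightarrow> real \<Rightarrow> real \<Rightarrow> nat set \<Rightarrow> (nat \<times> int) set" where
  "frac_set \<gamma> u v T = {p. fst p \<in> T \<and> u \<le> shifted_frac \<gamma> p \<and> shifted_frac \<gamma> p \<le> v}"

lemma frac_set_eq_Sigma:
  assumes "0 \<notin> T"
  shows "frac_set \<gamma> u v T = (SIGMA q:T. {a. q * u - \<gamma> \<le> of_int a \<and> of_int a \<le> q * v - \<gamma>})"
proof -
  have "u \<le> shifted_frac \<gamma> (q, a) \<longleftrightarrow> q * u - \<gamma> \<le> of_int a"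
       "shifted_frac \<gamma> (q, a) \<le> v \<longleftrightarrow> of_int a \<le> q * v - \<gamma>" if "q \<in> T" for q a
  proof -
    have "0 < real q" using that assms by (cases q) auto
    then show "u \<le> shifted_frac \<gamma> (q, a) \<longleftrightarrow> q * u - \<gamma> \<le> of_int a"
       "shifted_frac \<gamma> (q, a) \<le> v \<longleftrightarrow> of_int a \<le> q * v - \<gamma>"
      by (auto simp: shifted_frac_def pos_le_divide_eq pos_divide_le_eq algebra_simps)
  qed
  then show ?thesis by (auto simp: frac_set_def)
qed

lemma finite_frac_set:
  assumes "finite T" "0 \<notin> T"
  shows "finite (frac_set \<gamma> u v T)"
  using assms by (simp add: frac_set_eq_Sigma ints_in_interval_eq)

text \<open>For each q the numerators are the integers in an interval of length q (v - u), counted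
  up to an error 1. As N \<le> q < 2N and N (v - u) \<ge> 1, their number is between N (v - u) - 1
  and 3 N (v - u).\<close>

lemma card_frac_set:
  assumes T: "T \<subseteq> {N..<2 * N}" and N: "N \<ge> 1" and uv: "u < v" and NL: "real N * (v - u) \<ge> 1"
  shows "card T * (real N * (v - u) - 1) \<le> card (frac_set \<gamma> u v T)"
    and "card (frac_set \<gamma> u v T) \<le> 3 * (real N)\<^sup>2 * (v - u)"
proof -
  have 0: "0 \<notin> T" and fin: "finite T" using T N finite_subset by fastforce+
  define A where "A q = {a::int. q * u - \<gamma> \<le> of_int a \<and> of_int a \<le> q * v - \<gamma>}" for q :: nat
  have card: "card (frac_set \<gamma> u v T) = (\<Sum>q\<in>T. card (A q))"
    unfolding frac_set_eq_Sigma[OF 0] A_def using fin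
    by (subst card_SigmaI) (auto simp: ints_in_interval_eq)
  have "card T * (real N * (v - u) - 1) = (\<Sum>q\<in>T. real N * (v - u) - 1)" by simp
  also have "\<dots> \<le> (\<Sum>q\<in>T. real (card (A q)))"
  proof (rule sum_mono)
    fix q assume "q \<in> T"
    then have "real N * (v - u) \<le> real q * (v - u)" using T uv by (intro mult_right_mono) auto
    also have "\<dots> = q * v - \<gamma> - (q * u - \<gamma>)" by (simp add: algebra_simps)
    finally show "real N * (v - u) - 1 \<le> card (A q)"
      using card_ints_in_interval_ge[of "q * v - \<gamma>" "q * u - \<gamma>"] unfolding A_def by linarith
  qed
  finally show "card T * (real N * (v - u) - 1) \<le> card (frac_set \<gamma> u v T)" by (simp add: card)
  have "(\<Sum>q\<in>T. real (card (A q))) \<le> (\<Sum>q\<in>T. 3 * real N * (v - u))"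
  proof (rule sum_mono)
    fix q assume "q \<in> T"
    then have "real q * (v - u) \<le> 2 * real N * (v - u)" using T uv by (intro mult_right_mono) auto
    moreover have "real q * (v - u) = q * v - \<gamma> - (q * u - \<gamma>)" by (simp add: algebra_simps)
    moreover have "0 \<le> real q * (v - u)" using uv by simp
    ultimately show "card (A q) \<le> 3 * real N * (v - u)"
      using card_ints_in_interval_le[of "q * u - \<gamma>" "q * v - \<gamma>"] NL unfolding A_def by linarith
  qed
  also have "\<dots> = card T * (3 * real N * (v - u))" by simp
  also have "\<dots> \<le> N * (3 * real N * (v - u))"
    using uv card_mono[OF _ T] by (intro mult_right_mono) auto
  finally show "card (frac_set \<gamma> u v T) \<le> 3 * (real N)\<^sup>2 * (v - u)"
    by (simp add: card power2_eq_square mult_ac)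
qed

section \<open>Points close to rationals of small denominator\<close>

text \<open>Thus x lies within 1/(8 s N) of m/s. The fraction need not be reduced, so that a
  difference of two denominators can serve as s directly.\<close>

definition near_rational :: "nat \<Rightarrow> nat \<Rightarrow> real \<Rightarrow> bool" where
  "near_rational K N x \<longleftrightarrow>
    (\<exists>s\<ge>1. K * s \<le> N \<and> (\<exists>m::int. \<bar>real s * x - of_int m\<bar> \<le> 1 / (8 * real N)))"

text \<open>Cancelling the gcd of m and s divides s and the error by the same positive integer, so
  both bounds survive.\<close>

lemma near_rational_coprime:
  assumes "near_rational K N x"
  obtains s :: nat and m :: int where "s \<ge> 1" "K * s \<le> N" "coprime m (int s)"
    "\<bar>real s * x - of_int m\<bar> \<le> 1 / (8 * real N)"
proof -
  obtain s :: nat and m :: int where sm: "s \<ge> 1" "K * s \<le> N"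
    "\<bar>real s * x - of_int m\<bar> \<le> 1 / (8 * real N)"
    using assms unfolding near_rational_def by blast
  define g where "g = gcd m (int s)"
  have g: "g \<ge> 1" unfolding g_def using sm(1) by (smt (verit) gcd_pos_int of_nat_0_less_iff zero_less_one_class.zero_less_one less_le_trans of_nat_1 of_nat_le_iff)
  obtain m' s0 where ms: "m = g * m'" "int s = g * s0" "coprime m' s0"
    using gcd_coprime_exists[of m "int s"] g unfolding g_def by (metis mult.commute not_one_le_zero)
  have s0: "s0 \<ge> 1" using ms(2) sm(1) g
    by (smt (verit) mult_nonneg_nonpos of_nat_1 of_nat_le_iff)
  define s' where "s' = nat s0"
  have s': "int s' = s0" "s' \<ge> 1" using s0 by (auto simp: s'_def)
  have sg: "real s = g * real s'"
    using ms(2) s' by (metis of_int_mult of_int_of_nat_eq)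
  have "s' \<le> s"
    using sg g s'(2) by (smt (verit) mult_le_cancel_right1 of_int_1_le_iff of_nat_0_le_iff of_nat_le_iff)
  then have "K * s' \<le> N" using sm(2) by (meson le_trans mult_le_mono2)
  moreover have "\<bar>real s' * x - m'\<bar> \<le> \<bar>real s * x - m\<bar>"
  proof -
    have "\<bar>real s * x - m\<bar> = real_of_int g * \<bar>real s' * x - m'\<bar>"
      using g by (simp add: sg ms(1) abs_mult right_diff_distrib [symmetric] mult.assoc)
    moreover have "1 * \<bar>real s' * x - m'\<bar> \<le> real_of_int g * \<bar>real s' * x - m'\<bar>"
      using g by (intro mult_right_mono) auto
    ultimately show ?thesis by simp
  qed
  ultimately show ?thesis using that[of s' m'] s' sm(3) ms(3) by auto
qed

text \<open>If (q, a) and (r, b) both belong to Q, then s (a - b) - (q - r) m is an integer of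
  absolute value at most 1/2, hence 0. By coprimality s divides q - r, and q = r forces a = b. So
  each window of s consecutive denominators holds at most one pair.\<close>

lemma card_frac_near_reduced:
  fixes s N :: nat and m :: int and \<gamma> :: real
  assumes "1 \<le> s" "s \<le> N" and cop: "coprime m (int s)"
  defines "Q \<equiv> {p. fst p \<in> {N..<2 * N} \<and> \<bar>real s * shifted_frac \<gamma> p - of_int m\<bar> \<le> 1 / (8 * real N)}"
  shows "finite Q" "card Q \<le> 2 * real N / real s"
proof -
  define f where "f p = (fst p - N) div s" for p :: "nat \<times> int"
  have inj: "inj_on f Q"
  proof (rule inj_onI)
    fix p p' assume pQ: "p \<in> Q" "p' \<in> Q" and eq: "f p = f p'"
    obtain q a r b where p: "p = (q, a)" "p' = (r, b)" by (cases p, cases p')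
    \<comment> \<open>The factor 8 in \<open>near_rational\<close> is made for this: q < 2N turns
      1/(8N) into 1/4, and two such errors stay below 1.\<close>
    have bnd: "\<bar>real s * (of_int a + \<gamma>) - real q * of_int m\<bar> \<le> 1 / 4"
      if "(q, a) \<in> Q" for q a
    proof -
      have q: "N \<le> q" "q < 2 * N" using that by (auto simp: Q_def)
      then have "real s * (of_int a + \<gamma>) - real q * of_int m
          = real q * (real s * shifted_frac \<gamma> (q, a) - of_int m)"
        using assms(1,2) by (simp add: shifted_frac_def field_simps)
      then have "\<bar>real s * (of_int a + \<gamma>) - real q * of_int m\<bar>
          = real q * \<bar>real s * shifted_frac \<gamma> (q, a) - of_int m\<bar>" by (simp add: abs_mult)
      also have "\<dots> \<le> (2 * real N) * (1 / (8 * real N))"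
        using that q by (intro mult_mono) (auto simp: Q_def)
      finally show ?thesis using q by simp
    qed
    have "\<bar>real_of_int (int s * (a - b) - (int q - int r) * m)\<bar>
      = \<bar>(real s * (of_int a + \<gamma>) - real q * of_int m) - (real s * (of_int b + \<gamma>) - real r * of_int m)\<bar>"
      by (simp add: algebra_simps)
    also have "\<dots> < 1" using bnd[of q a] bnd[of r b] pQ unfolding p by linarith
    finally have e: "int s * (a - b) = (int q - int r) * m" by linarith
    then have "int s dvd (int q - int r) * m" by (metis dvd_triv_left)
    then have dvd: "int s dvd int q - int r"
      using cop by (simp add: coprime_dvd_mult_left_iff coprime_commute)
    have "(q - N) div s = (r - N) div s" using eq by (simp add: f_def p)
    moreover have "N \<le> q" "N \<le> r" using pQ p by (auto simp: Q_def)
    moreover have "(q - N) mod s = (r - N) mod s"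
    proof -
      have "int (q - N) - int (r - N) = int q - int r" using \<open>N \<le> q\<close> \<open>N \<le> r\<close> by simp
      then have "int (q - N) mod int s = int (r - N) mod int s" using dvd by (simp add: mod_eq_dvd_iff)
      then show ?thesis by (metis of_nat_eq_iff zmod_int)
    qed
    ultimately have "q = r" by (metis div_mult_mod_eq le_add_diff_inverse)
    with e assms(1) show "p = p'" by (simp add: p)
  qed
  \<comment> \<open>Since q - N \<le> N - 1, there are at most (N - 1) div s + 1 windows; s \<le> N
    then absorbs the extra one into 2N/s.\<close>
  have sub: "f ` Q \<subseteq> {..(N - 1) div s}"
    by (auto simp: f_def Q_def intro!: div_le_mono)
  show "finite Q" using inj sub finite_imageD finite_subset by blast
  have "card Q \<le> card {..(N - 1) div s}" using inj sub by (intro card_inj_on_le) auto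
  also have "\<dots> = (N - 1) div s + 1" by simp
  finally have "real (card Q) \<le> real ((N - 1) div s) + 1" by linarith
  also have "real ((N - 1) div s) \<le> real N / real s"
    by (rule order_trans[OF of_nat_div_le_of_nat divide_right_mono]) auto
  also have "1 \<le> real N / real s" using assms by simp
  finally show "card Q \<le> 2 * real N / real s" by simp
qed

text \<open>The difference \<open>harm n - ln n\<close> decreases and equals 1 at n = 1.\<close>

lemma harm_le_ln: "n \<ge> 1 \<Longrightarrow> harm n \<le> ln (real n) + 1"
  using decseqD[OF decseq_harm_diff_ln, of 0 "n - 1"] by (simp add: harm_def)

text \<open>Each s has at most s (v - u) + 3 numerators m coprime to it, each claiming at most 2N/s
  pairs, a total of 2N (v - u) + 6N/s. Over s \<le> N/K the first part gives the main term and the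
  second a harmonic sum.\<close>

lemma card_near_rational:
  fixes \<gamma> u v :: real and N K :: nat
  assumes N: "N \<ge> 1" and K: "K \<ge> 1" and uv: "u < v"
  defines "B \<equiv> {p \<in> frac_set \<gamma> u v {N..<2 * N}. near_rational K N (shifted_frac \<gamma> p)}"
  shows "card B \<le> 2 * (real N)\<^sup>2 * (v - u) / K + 6 * real N * (ln (real N) + 1)"
proof -
  \<comment> \<open>The range of m is widened by 1 at both ends, because m differs from s x by up to
    1/(8N) \<le> 1.\<close>
  define Z where "Z s = {m::int. s * u - 1 \<le> of_int m \<and> of_int m \<le> s * v + 1 \<and> coprime m (int s)}" for s :: nat
  define Q where "Q s m = {p. fst p \<in> {N..<2 * N} \<and> \<bar>real s * shifted_frac \<gamma> p - of_int m\<bar> \<le> 1 / (8 * real N)}"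
    for s :: nat and m :: int
  define S where "S = {1..N div K}"
  have SN: "1 \<le> s" "s \<le> N" "real s \<le> real N / K" if "s \<in> S" for s
  proof -
    show "1 \<le> s" using that by (simp add: S_def)
    have "s \<le> N div K" using that by (simp add: S_def)
    then show "s \<le> N" using div_le_dividend le_trans by blast
    have "K * s \<le> N" using \<open>s \<le> N div K\<close> K by (simp add: less_eq_div_iff_mult_less_eq mult.commute)
    then have "real s * real K \<le> real N" by (metis mult.commute of_nat_le_iff of_nat_mult)
    then show "real s \<le> real N / K" using K by (simp add: pos_le_divide_eq)
  qed
  have fin: "finite {m::int. s * u - 1 \<le> of_int m \<and> of_int m \<le> s * v + 1}" for s :: nat
    by (simp only: ints_in_interval_eq finite_atLeastAtMost_int)
  have finZ: "finite (Z s)" for s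
    by (rule finite_subset[OF _ fin[of s]]) (auto simp: Z_def)
  have cardZ: "card (Z s) \<le> s * (v - u) + 3" for s
  proof -
    have "card (Z s) \<le> card {m::int. s * u - 1 \<le> of_int m \<and> of_int m \<le> s * v + 1}"
      by (rule card_mono[OF fin]) (auto simp: Z_def)
    moreover have "s * u \<le> s * v" using uv by (intro mult_left_mono) auto
    ultimately show ?thesis
      using card_ints_in_interval_le[of "s * u - 1" "s * v + 1"] by (simp add: algebra_simps)
  qed
  have Q: "finite (Q s m)" "card (Q s m) \<le> 2 * real N / real s" if "s \<in> S" "m \<in> Z s" for s m
    using card_frac_near_reduced[of s N m \<gamma>] SN[OF that(1)] that(2) by (auto simp: Q_def Z_def)
  have "B \<subseteq> (\<Union>s\<in>S. \<Union>m\<in>Z s. Q s m)"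
  proof
    fix p assume "p \<in> B"
    then have p: "fst p \<in> {N..<2 * N}" "u \<le> shifted_frac \<gamma> p" "shifted_frac \<gamma> p \<le> v"
      "near_rational K N (shifted_frac \<gamma> p)" by (auto simp: B_def frac_set_def)
    obtain s :: nat and m :: int where sm: "s \<ge> 1" "K * s \<le> N" "coprime m (int s)"
      "\<bar>real s * shifted_frac \<gamma> p - of_int m\<bar> \<le> 1 / (8 * real N)"
      using near_rational_coprime[OF p(4)] by blast
    have "s \<in> S" using sm K by (simp add: S_def less_eq_div_iff_mult_less_eq mult.commute)
    moreover have "m \<in> Z s"
    proof -
      have "1 / (8 * real N) \<le> 1" using N by simp
      moreover have "s * u \<le> s * shifted_frac \<gamma> p" "s * shifted_frac \<gamma> p \<le> s * v"
        using p by (auto intro: mult_left_mono)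
      ultimately show ?thesis using sm(3,4) unfolding Z_def by (simp add: abs_le_iff)
    qed
    moreover have "p \<in> Q s m" using sm(4) p(1) by (simp add: Q_def)
    ultimately show "p \<in> (\<Union>s\<in>S. \<Union>m\<in>Z s. Q s m)" by blast
  qed
  then have "card B \<le> card (\<Union>s\<in>S. \<Union>m\<in>Z s. Q s m)"
    using Q finZ by (intro card_mono) (auto simp: S_def)
  also have "\<dots> \<le> (\<Sum>s\<in>S. card (\<Union>m\<in>Z s. Q s m))" by (rule card_UN_le) (simp add: S_def)
  also have "\<dots> \<le> (\<Sum>s\<in>S. \<Sum>m\<in>Z s. card (Q s m))" using finZ by (intro sum_mono card_UN_le)
  finally have "real (card B) \<le> (\<Sum>s\<in>S. \<Sum>m\<in>Z s. real (card (Q s m)))"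
    by (metis (mono_tags, lifting) of_nat_le_iff of_nat_sum sum.cong)
  also have "\<dots> \<le> (\<Sum>s\<in>S. 2 * real N * (v - u) + 6 * real N * inverse s)"
  proof (rule sum_mono)
    fix s assume s: "s \<in> S"
    have "(\<Sum>m\<in>Z s. real (card (Q s m))) \<le> (\<Sum>m\<in>Z s. 2 * real N / real s)"
      using Q s by (intro sum_mono) auto
    also have "\<dots> = real (card (Z s)) * (2 * real N / real s)" by simp
    also have "\<dots> \<le> (s * (v - u) + 3) * (2 * real N / real s)"
      using cardZ by (intro mult_right_mono) auto
    also have "\<dots> = 2 * real N * (v - u) + 6 * real N * inverse s"
      using SN[OF s] by (simp add: field_simps)
    finally show "(\<Sum>m\<in>Z s. real (card (Q s m))) \<le> 2 * real N * (v - u) + 6 * real N * inverse s" .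
  qed
  also have "\<dots> = real (N div K) * (2 * real N * (v - u)) + 6 * real N * harm (N div K)"
    by (simp add: sum.distrib S_def harm_def sum_distrib_left)
  also have "\<dots> \<le> (real N / K) * (2 * real N * (v - u)) + 6 * real N * (ln (real N) + 1)"
  proof (intro add_mono mult_right_mono mult_left_mono)
    show "real (N div K) \<le> real N / K" by (rule of_nat_div_le_of_nat)
    have "harm (N div K) \<le> (harm N :: real)"
      unfolding harm_def by (intro sum_mono2) (auto simp: div_le_dividend intro: le_trans)
    then show "harm (N div K) \<le> ln (real N) + 1" using harm_le_ln[OF N] by linarith
  qed (use uv in auto)
  finally show ?thesis by (simp add: power2_eq_square mult_ac)
qed

lemma card_frac_in_ball:
  fixes N K :: nat and \<gamma> t h :: real
  assumes N: "N \<ge> 1" and K: "K \<ge> 1" and "h \<ge> 0"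
    and P: "fst ` P \<subseteq> {N..<2 * N}" "\<And>p. p \<in> P \<Longrightarrow> \<not> near_rational K N (shifted_frac \<gamma> p)"
  shows "finite {p \<in> P. \<bar>shifted_frac \<gamma> p - t\<bar> < h}"
    and "card {p \<in> P. \<bar>shifted_frac \<gamma> p - t\<bar> < h} \<le> 32 * real K * (h * (real N)\<^sup>2 + 1)"
proof -
  define R where "R = {p \<in> P. \<bar>shifted_frac \<gamma> p - t\<bar> < h}"
  (* p is encoded by the cell of length 1 / (16 N^2) of its fraction and the cell of length N / K of
     its denominator: two denominators q > r in the same cells would make the fraction near a
     rational with denominator q - r. *)
  define c where "c p = \<lfloor>(shifted_frac \<gamma> p - (t - h)) * (16 * (real N)\<^sup>2)\<rfloor>" for p
  define d where "d p = K * (fst p - N) div N" for p :: "nat \<times> int"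
  have close: "\<bar>shifted_frac \<gamma> p - shifted_frac \<gamma> p'\<bar> < 1 / (16 * (real N)\<^sup>2)" if "c p = c p'" for p p'
  proof -
    have "\<bar>(shifted_frac \<gamma> p - (t - h)) * (16 * (real N)\<^sup>2) - (shifted_frac \<gamma> p' - (t - h)) * (16 * (real N)\<^sup>2)\<bar> < 1"
      using that unfolding c_def by linarith
    also have "(shifted_frac \<gamma> p - (t - h)) * (16 * (real N)\<^sup>2) - (shifted_frac \<gamma> p' - (t - h)) * (16 * (real N)\<^sup>2)
       = (shifted_frac \<gamma> p - shifted_frac \<gamma> p') * (16 * (real N)\<^sup>2)" by (simp add: algebra_simps)
    finally show ?thesis using N by (simp add: abs_mult pos_less_divide_eq)
  qed
  have no_less: False if pP: "(q, a) \<in> P" "(r, b) \<in> P" and e: "c (q, a) = c (r, b)" "d (q, a) = d (r, b)" and "r < q"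
    for q r a b
  proof -
    have qr: "N \<le> r" "q < 2 * N" using P(1) pP by force+
    have "K * (q - N) < K * (r - N) + N"
    proof -
      have "K * (q - N) = d (q, a) * N + (K * (q - N)) mod N"
        and "K * (r - N) = d (r, b) * N + (K * (r - N)) mod N" by (simp_all add: d_def)
      moreover have "d (q, a) * N = d (r, b) * N" using e by simp
      moreover have "(K * (q - N)) mod N < N" using N by simp
      ultimately show ?thesis by linarith
    qed
    moreover have "q - N = (r - N) + (q - r)" using qr \<open>r < q\<close> by simp
    then have "K * (q - N) = K * (r - N) + K * (q - r)" by (metis distrib_left)
    ultimately have Ks: "K * (q - r) \<le> N" by linarith
    have x: "real q * shifted_frac \<gamma> (q, a) = of_int a + \<gamma>" "real r * shifted_frac \<gamma> (r, b) = of_int b + \<gamma>"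
      using qr N \<open>r < q\<close> by (auto simp: shifted_frac_def)
    \<comment> \<open>The shift \<gamma> cancels in the difference: with s = q - r and m = a - b, s
      x - m = r (x' - x) for the two fractions x, x'. As r < 2N, equal cells bound this by 2N / (16
      N^2) = 1/(8N).\<close>
    have "real (q - r) * shifted_frac \<gamma> (q, a) - of_int (a - b)
       = real r * (shifted_frac \<gamma> (r, b) - shifted_frac \<gamma> (q, a))"
      using x \<open>r < q\<close> by (simp add: algebra_simps)
    then have "\<bar>real (q - r) * shifted_frac \<gamma> (q, a) - of_int (a - b)\<bar>
       = real r * \<bar>shifted_frac \<gamma> (q, a) - shifted_frac \<gamma> (r, b)\<bar>" by (simp add: abs_mult abs_minus_commute)
    also have "\<dots> \<le> (2 * real N) * (1 / (16 * (real N)\<^sup>2))"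
      using qr \<open>r < q\<close> close[OF e(1)] by (intro mult_mono) auto
    also have "\<dots> = 1 / (8 * real N)" using N by (simp add: power2_eq_square)
    finally have "near_rational K N (shifted_frac \<gamma> (q, a))"
      unfolding near_rational_def using Ks \<open>r < q\<close> by (intro exI[of _ "q - r"]) (auto intro: exI[of _ "a - b"])
    then show False using P(2) pP by blast
  qed
  have inj: "inj_on (\<lambda>p. (c p, d p)) R"
  proof (rule inj_onI)
    fix p p' assume pR: "p \<in> R" "p' \<in> R" and "(c p, d p) = (c p', d p')"
    then have e: "c p = c p'" "d p = d p'" by auto
    obtain q a r b where p: "p = (q, a)" "p' = (r, b)" by (cases p, cases p')
    have pP: "(q, a) \<in> P" "(r, b) \<in> P" using pR p by (auto simp: R_def)
    have qr: "q = r"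
      using no_less[OF pP] no_less[OF pP(2,1)] e unfolding p by (metis nat_neq_iff)
    have q: "N \<le> q" "q < 2 * N" using P(1) pP by force+
    \<comment> \<open>For equal denominators, equal cells make the numerators differ by at most
      1/(8N) < 1.\<close>
    have "\<bar>real_of_int (a - b)\<bar> = real q * \<bar>shifted_frac \<gamma> p - shifted_frac \<gamma> p'\<bar>"
      using q N unfolding p shifted_frac_def qr
      by (simp add: diff_divide_distrib[symmetric])
    also have "\<dots> \<le> (2 * real N) * (1 / (16 * (real N)\<^sup>2))"
      using q close[OF e(1)] by (intro mult_mono) auto
    also have "\<dots> < 1" using N by (simp add: power2_eq_square)
    finally have "a = b" by linarith
    with qr show "p = p'" by (simp add: p)
  qed
  \<comment> \<open>A window of length 2h meets at most 32 h N^2 + 1 cells, and q - N < N leaves K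
    values for \<open>d\<close>. The extra 1 is rounded up to 32 below to share the factor.\<close>
  have sub: "(\<lambda>p. (c p, d p)) ` R \<subseteq> {0..\<lfloor>32 * h * (real N)\<^sup>2\<rfloor>} \<times> {..<K}"
  proof (intro image_subsetI SigmaI)
    fix p assume "p \<in> R"
    then have *: "0 \<le> shifted_frac \<gamma> p - (t - h)" "shifted_frac \<gamma> p - (t - h) \<le> 2 * h" "p \<in> P" by (auto simp: R_def)
    then have "(shifted_frac \<gamma> p - (t - h)) * (16 * (real N)\<^sup>2) \<le> 2 * h * (16 * (real N)\<^sup>2)"
      by (intro mult_right_mono) auto
    then have "c p \<le> \<lfloor>32 * h * (real N)\<^sup>2\<rfloor>" unfolding c_def by (intro floor_mono) (simp add: mult_ac)
    moreover have "0 \<le> c p" unfolding c_def using * by simp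
    ultimately show "c p \<in> {0..\<lfloor>32 * h * (real N)\<^sup>2\<rfloor>}" by simp
    have "fst p < 2 * N" using P(1) *(3) by force
    then have "K * (fst p - N) < K * N" using K N by (intro mult_strict_left_mono) auto
    then show "d p \<in> {..<K}" by (simp add: d_def less_mult_imp_div_less)
  qed
  show "finite {p \<in> P. \<bar>shifted_frac \<gamma> p - t\<bar> < h}"
    using finite_subset[OF sub] finite_imageD[OF _ inj] unfolding R_def by auto
  have "card R \<le> card ({0..\<lfloor>32 * h * (real N)\<^sup>2\<rfloor>} \<times> {..<K})"
    using inj sub by (intro card_inj_on_le) auto
  also have "\<dots> = nat (\<lfloor>32 * h * (real N)\<^sup>2\<rfloor> + 1) * K" by (simp add: card_cartesian_product)
  finally have "real (card R) \<le> real (nat (\<lfloor>32 * h * (real N)\<^sup>2\<rfloor> + 1)) * K"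
    by (metis of_nat_le_iff of_nat_mult)
  also have "\<dots> \<le> (32 * h * (real N)\<^sup>2 + 32) * K"
  proof (intro mult_right_mono)
    have "0 \<le> 32 * h * (real N)\<^sup>2" using \<open>h \<ge> 0\<close> by simp
    then show "real (nat (\<lfloor>32 * h * (real N)\<^sup>2\<rfloor> + 1)) \<le> 32 * h * (real N)\<^sup>2 + 32" by linarith
  qed simp
  finally show "card {p \<in> P. \<bar>shifted_frac \<gamma> p - t\<bar> < h} \<le> 32 * real K * (h * (real N)\<^sup>2 + 1)"
    unfolding R_def by (simp add: algebra_simps)
qed

text \<open>A set T filling a proportion 1/l of the block yields at least N^2 (v - u)/(2l) pairs.
  The near-rational ones, counted over the whole block, are at most half of this number; the rest is
  kept.\<close>

lemma obtain_spread_fracs: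
  fixes T :: "nat set"
  assumes T: "T \<subseteq> {N..<2 * N}" "N \<le> l * card T" and N: "N \<ge> 1" and l: "l \<ge> 1" and uv: "u < v"
    and large: "48 * real l * (ln (real N) + 1) \<le> N * (v - u)"
  obtains P where "P \<subseteq> frac_set \<gamma> u v T" "finite P"
    "(real N)\<^sup>2 * (v - u) / (4 * l) \<le> card P"
    "card P \<le> 3 * (real N)\<^sup>2 * (v - u)"
    "\<And>t h. h \<ge> 0 \<Longrightarrow> real (card {p \<in> P. \<bar>shifted_frac \<gamma> p - t\<bar> < h}) \<le> 512 * real l * (h * (real N)\<^sup>2 + 1)"
proof -
  \<comment> \<open>This K makes the main term of the near-rational count N^2 (v - u)/(8l);
    \<open>large\<close> bounds its logarithmic term by the same amount. The spread constant becomes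
    32 * 16 l = 512 l.\<close>
  define K where "K = 16 * l"
  define B where "B = {p \<in> frac_set \<gamma> u v {N..<2 * N}. near_rational K N (shifted_frac \<gamma> p)}"
  define P where "P = frac_set \<gamma> u v T - B"
  define L where "L = v - u"
  have fin: "finite (frac_set \<gamma> u v {N..<2 * N})" "finite (frac_set \<gamma> u v T)"
    using T N by (auto intro!: finite_frac_set intro: finite_subset)
  have finB: "finite B" unfolding B_def using fin by auto
  \<comment> \<open>Replacing ln N and l by their least values 0 and 1 in \<open>large\<close> gives
    N L \<ge> 48, so that N L - 1 \<ge> N L / 2.\<close>
  have "48 * 1 * (0 + 1) \<le> 48 * real l * (ln (real N) + 1)"
    using l N by (intro mult_mono) auto
  then have NL: "real N * L \<ge> 48" using order_trans[OF _ large, of "48 * 1 * (0 + 1)"] unfolding L_def by simp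
  have "real N * (real N * L / 2) \<le> real N * (real N * L - 1)"
    using NL by (intro mult_left_mono) (linarith, simp)
  also have "\<dots> \<le> real (l * card T) * (real N * L - 1)"
    using T(2) NL by (intro mult_right_mono) (simp only: of_nat_le_iff, linarith)
  also have "\<dots> = real l * (card T * (real N * L - 1))" by simp
  also have "\<dots> \<le> real l * card (frac_set \<gamma> u v T)"
    using card_frac_set(1)[OF T(1) N uv] NL by (intro mult_left_mono) (auto simp: L_def)
  finally have lower: "(real N)\<^sup>2 * L / 2 \<le> real l * card (frac_set \<gamma> u v T)"
    by (simp add: power2_eq_square mult_ac)
  have "card B \<le> 2 * (real N)\<^sup>2 * (v - u) / K + 6 * real N * (ln (real N) + 1)"
    unfolding B_def using N uv l by (intro card_near_rational) (auto simp: K_def)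
  then have "real l * card B \<le> real l * (2 * (real N)\<^sup>2 * L / K + 6 * real N * (ln (real N) + 1))"
    unfolding L_def by (intro mult_left_mono) auto
  also have "\<dots> = (real N)\<^sup>2 * L / 8 + (48 * real l * (ln (real N) + 1)) * real N / 8"
    using l by (simp add: K_def field_simps)
  also have "\<dots> \<le> (real N)\<^sup>2 * L / 8 + (N * L) * real N / 8"
    using large unfolding L_def by (intro add_mono divide_right_mono mult_right_mono) (use uv in auto)
  also have "\<dots> = (real N)\<^sup>2 * L / 4" by (simp add: power2_eq_square)
  finally have upper: "real l * card B \<le> (real N)\<^sup>2 * L / 4" .
  have "card (frac_set \<gamma> u v T) \<le> card (P \<union> B)"
    unfolding P_def using finB fin by (intro card_mono) auto
  also have "\<dots> \<le> card P + card B" by (rule card_Un_le)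
  finally have "real l * card (frac_set \<gamma> u v T) \<le> real l * (card P + card B)"
    by (intro mult_left_mono) auto
  then have "(real N)\<^sup>2 * L / 4 \<le> real l * card P" using lower upper by (simp add: algebra_simps)
  then have 1: "(real N)\<^sup>2 * (v - u) / (4 * l) \<le> card P"
    using l by (simp add: L_def pos_divide_le_eq mult_ac)
  have "card P \<le> card (frac_set \<gamma> u v T)" unfolding P_def using fin by (intro card_mono) auto
  then have 2: "card P \<le> 3 * (real N)\<^sup>2 * (v - u)"
    using card_frac_set(2)[OF T(1) N uv, of \<gamma>] NL unfolding L_def by linarith
  have 3: "card {p \<in> P. \<bar>shifted_frac \<gamma> p - t\<bar> < h} \<le> 512 * real l * (h * (real N)\<^sup>2 + 1)" if "h \<ge> 0" for t h
  proof -
    have "card {p \<in> P. \<bar>shifted_frac \<gamma> p - t\<bar> < h} \<le> 32 * real K * (h * (real N)\<^sup>2 + 1)"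
      using N l that T(1)
      by (intro card_frac_in_ball) (auto simp: K_def P_def B_def frac_set_def)
    then show ?thesis by (simp add: K_def)
  qed
  show ?thesis using that[of P] 1 2 3 fin by (auto simp: P_def)
qed

subsection \<open>Divergence and partitions\<close>

text \<open>If the truncated series converged, its terms would tend to 0, so the truncation would
  eventually be inactive.\<close>

lemma not_summable_min:
  fixes a :: "nat \<Rightarrow> real"
  assumes "\<not> summable a" "b > 0"
  shows "\<not> summable (\<lambda>k. min b (a k))"
proof
  assume s: "summable (\<lambda>k. min b (a k))"
  then have "(\<lambda>k. min b (a k)) \<longlonglongrightarrow> 0" by (rule summable_LIMSEQ_zero)
  then have "\<forall>\<^sub>F k in sequentially. min b (a k) < b" using \<open>b > 0\<close> by (rule order_tendstoD)
  then have "\<forall>\<^sub>F k in sequentially. min b (a k) = a k" by eventually_elim auto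
  then have "summable (\<lambda>k. min b (a k)) \<longleftrightarrow> summable a" by (rule summable_cong)
  with s assms show False by simp
qed

text \<open>Cauchy condensation with the index moved by one: \<psi> is taken at the right end
  2^(k+1) of block k, where it bounds \<psi> on the block from below.\<close>

lemma not_summable_condensed:
  fixes \<psi> :: "nat \<Rightarrow> real"
  assumes nonneg: "\<And>q. q \<ge> 1 \<Longrightarrow> 0 \<le> \<psi> q"
    and mono: "\<And>q. q \<ge> 1 \<Longrightarrow> \<psi> (q + 1) \<le> \<psi> q"
    and div: "(\<Sum>q. ennreal (\<psi> (Suc q))) = \<infinity>"
  shows "\<not> summable (\<lambda>k. 2 ^ k * \<psi> (2 ^ Suc k))"
proof -
  \<comment> \<open>The value \<psi> 0 is unconstrained; 0 in its place makes the sequence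
    nonnegative.\<close>
  define f where "f n = (if n = 0 then 0 else \<psi> n)" for n
  have "\<not> summable (\<lambda>q. \<psi> (Suc q))"
  proof
    assume "summable (\<lambda>q. \<psi> (Suc q))"
    then have "(\<Sum>q. ennreal (\<psi> (Suc q))) = ennreal (\<Sum>q. \<psi> (Suc q))"
      using nonneg by (intro suminf_ennreal2) auto
    with div show False by simp
  qed
  then have "\<not> summable f"
    unfolding summable_Suc_iff[of f, symmetric] by (simp add: f_def)
  then have "\<not> summable (\<lambda>n. 2 ^ n * f (2 ^ n))"
    using condensation_test[of f] mono nonneg by (auto simp: f_def)
  then have "\<not> summable (\<lambda>n. 2 ^ Suc n * f (2 ^ Suc n))"
    by (subst summable_Suc_iff)
  then have "\<not> summable (\<lambda>n. 2 * (2 ^ n * \<psi> (2 ^ Suc n)))"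
    by (simp add: f_def mult.assoc)
  then show ?thesis using summable_mult by blast
qed

text \<open>Every k is served by some class, so the finite sum of the class series dominates c; it
  would converge if each of them did.\<close>

lemma ex_class_not_summable:
  fixes c :: "nat \<Rightarrow> real"
  assumes "finite P" and c: "\<And>k. 0 \<le> c k" "\<not> summable c"
    and ex: "\<And>k. \<exists>\<pi>\<in>P. Q \<pi> k"
  shows "\<exists>\<pi>\<in>P. \<not> summable (\<lambda>k. if Q \<pi> k then c k else 0)"
proof (rule ccontr)
  assume "\<not> ?thesis"
  then have "summable (\<lambda>k. \<Sum>\<pi>\<in>P. if Q \<pi> k then c k else 0)" by (intro summable_sum) auto
  moreover have "norm (c k) \<le> (\<Sum>\<pi>\<in>P. if Q \<pi> k then c k else 0)" for k
  proof -
    obtain \<pi> where \<pi>: "\<pi> \<in> P" "Q \<pi> k" using ex by blast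
    have "norm (c k) = (if Q \<pi> k then c k else 0)" using \<pi> c by simp
    also have "\<dots> \<le> (\<Sum>\<pi>\<in>P. if Q \<pi> k then c k else 0)"
      using assms \<pi> by (intro member_le_sum) auto
    finally show ?thesis .
  qed
  ultimately have "summable c" by (rule summable_comparison_test')
  with c show False by simp
qed

text \<open>Pigeonhole, multiplied out to stay within the natural numbers.\<close>

lemma ex_class_card_ge:
  assumes "finite P" "B \<subseteq> \<Union>P" "finite B" "B \<noteq> {}"
  shows "\<exists>\<pi>\<in>P. card B \<le> card P * card (\<pi> \<inter> B)"
proof (rule ccontr)
  assume "\<not> ?thesis"
  then have less: "card P * card (\<pi> \<inter> B) < card B" if "\<pi> \<in> P" for \<pi> using that by force
  have "P \<noteq> {}" using assms by auto
  have "B = (\<Union>\<pi>\<in>P. \<pi> \<inter> B)" using assms by auto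
  then have "card B \<le> (\<Sum>\<pi>\<in>P. card (\<pi> \<inter> B))" using card_UN_le[OF assms(1)] by metis
  then have "card P * card B \<le> (\<Sum>\<pi>\<in>P. card P * card (\<pi> \<inter> B))"
    by (metis mult_le_mono2 sum_distrib_left)
  also have "\<dots> < (\<Sum>\<pi>\<in>P. card B)" using less \<open>P \<noteq> {}\<close> assms by (intro sum_strict_mono) auto
  finally show False by simp
qed

section \<open>Distance to the nearest integer and measurability of W\<close>

lemma nearest_int_dist_le: "nearest_int_dist x \<le> \<bar>x - of_int m\<bar>"
  using round_diff_minimal[of x m] by (simp add: nearest_int_dist_def dist_real_def abs_minus_commute)

lemma borel_measurable_nearest_int_dist [measurable]: "nearest_int_dist \<in> borel_measurable borel"
  unfolding nearest_int_dist_def[abs_def] round_def dist_real_def by measurable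

lemma W_in_sets_lebesgue: "W \<psi> \<gamma> \<in> sets lebesgue"
proof -
  \<comment> \<open>Infinitude as unboundedness becomes a countable intersection of countable unions
    of Borel sets.\<close>
  have "W \<psi> \<gamma> = {\<alpha> \<in> space borel. \<alpha> \<in> {0..1} \<and>
      (\<forall>n. \<exists>q>n. 1 \<le> q \<and> nearest_int_dist (real q * \<alpha> - \<gamma>) < \<psi> q)}"
    by (auto simp: W_def infinite_nat_iff_unbounded)
  also have "\<dots> \<in> sets borel" by measurable
  finally show ?thesis by simp
qed

subsection \<open>The limsup set\<close>

text \<open>Every tail union of balls has at least the stated measure, because each tail of
  \<open>c\<close> has a partial sum \<ge> 1; the tail unions decrease, so their intersection
  inherits the bound. Only the starting level depends on the interval: the proportion depends on l
  alone.\<close>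

lemma local_measure_limsup_balls:
  fixes T :: "nat \<Rightarrow> nat set" and c :: "nat \<Rightarrow> real" and u v \<gamma> :: real
  assumes l: "l \<ge> 1" and c: "\<And>k. 0 \<le> c k" "\<And>k. c k \<le> 1" "\<not> summable c"
    and T: "\<And>k. T k \<subseteq> {2 ^ k..<2 * 2 ^ k}" "\<And>k. c k > 0 \<Longrightarrow> 2 ^ k \<le> l * card (T k)"
    and uv: "u < v"
  obtains A where "A \<in> lmeasurable" "A \<subseteq> {u..v}"
    "\<And>\<alpha>. \<alpha> \<in> A \<Longrightarrow> infinite {k. \<exists>p. fst p \<in> T k \<and> \<bar>\<alpha> - shifted_frac \<gamma> p\<bar> < c k / 4 ^ k}"
    "(1 / (4 * real l))\<^sup>2 / (9 * 3 * (512 * real l)) * (v - u) \<le> measure lebesgue A"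
proof -
  define \<kappa> where "\<kappa> = (1 / (4 * real l))\<^sup>2 / (9 * 3 * (512 * real l))"
  \<comment> \<open>As (ln N + 1)/N tends to 0, the hypothesis \<open>large\<close> of
    \<open>obtain_spread_fracs\<close> holds for N = 2^k from some \<open>k0\<close> on.\<close>
  have "((\<lambda>x. 48 * real l * ((ln x + 1) / x)) \<longlongrightarrow> 48 * real l * 0) (at_top :: real filter)"
    unfolding add_divide_distrib
    by (intro tendsto_intros tendsto_add_zero ln_x_over_x_tendsto_0
        tendsto_divide_0[OF tendsto_const] filterlim_at_top_imp_at_infinity filterlim_ident)
  then have "\<forall>\<^sub>F x in at_top. 48 * real l * ((ln x + 1) / x) < v - u"
    using uv by (intro order_tendstoD(2)) auto
  moreover have "filterlim (\<lambda>k. (2::real) ^ k) at_top sequentially"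
    by (rule filterlim_at_top_mono[OF filterlim_real_sequentially])
       (intro always_eventually allI, metis less_imp_le of_nat_less_two_power)
  ultimately have "\<forall>\<^sub>F k in sequentially. 48 * real l * ((ln (2 ^ k) + 1) / 2 ^ k) < v - u"
    by (rule eventually_compose_filterlim)
  then obtain k0 where k0: "48 * real l * ((ln (2 ^ k) + 1) / 2 ^ k) < v - u" if "k \<ge> k0" for k
    unfolding eventually_sequentially by blast
  have sq4: "(real (2 ^ k))\<^sup>2 = 4 ^ k" for k
    by (simp add: power2_eq_square power_mult_distrib [symmetric])
  \<comment> \<open>At a level with \<open>c k = 0\<close> the set \<open>T k\<close> may be sparse;
    the lower bound is waived there and the empty set is chosen.\<close>
  define good where "good k P \<longleftrightarrow> P \<subseteq> frac_set \<gamma> u v (T k) \<and> finite P \<and>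
      (c k > 0 \<longrightarrow> 1 / (4 * real l) * 4 ^ k * (v - u) \<le> card P) \<and> card P \<le> 3 * 4 ^ k * (v - u) \<and>
      (\<forall>t h. h \<ge> 0 \<longrightarrow> card {p \<in> P. \<bar>shifted_frac \<gamma> p - t\<bar> < h} \<le> 512 * real l * (h * 4 ^ k + 1))" for k P
  have "\<exists>P. good k P" if "k \<ge> k0" for k
  proof (cases "c k > 0")
    case True
    have large: "48 * real l * (ln (real (2 ^ k)) + 1) \<le> real (2 ^ k) * (v - u)"
      using k0[OF that] by (simp add: field_simps)
    obtain P where P: "P \<subseteq> frac_set \<gamma> u v (T k)" "finite P"
      "(real (2 ^ k))\<^sup>2 * (v - u) / (4 * l) \<le> card P"
      "card P \<le> 3 * (real (2 ^ k))\<^sup>2 * (v - u)"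
      "\<And>t h. h \<ge> 0 \<Longrightarrow> card {p \<in> P. \<bar>shifted_frac \<gamma> p - t\<bar> < h} \<le> 512 * real l * (h * (real (2 ^ k))\<^sup>2 + 1)"
      using obtain_spread_fracs[OF T(1) T(2)[OF True] _ l uv large] by auto
    then show ?thesis unfolding sq4 good_def by (intro exI[of _ P]) (auto simp: mult_ac)
  next
    case False
    then show ?thesis using uv unfolding good_def by (intro exI[of _ "{}"]) auto
  qed
  then obtain P where good: "\<And>k. k \<ge> k0 \<Longrightarrow> good k (P k)" by metis
  have P: "\<And>k. k \<ge> k0 \<Longrightarrow> P k \<subseteq> frac_set \<gamma> u v (T k)"
    "\<And>k. k \<ge> k0 \<Longrightarrow> finite (P k)"
    "\<And>k. k \<ge> k0 \<Longrightarrow> c k > 0 \<Longrightarrow> 1 / (4 * real l) * 4 ^ k * (v - u) \<le> card (P k)"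
    "\<And>k. k \<ge> k0 \<Longrightarrow> card (P k) \<le> 3 * 4 ^ k * (v - u)"
    "\<And>k t h. k \<ge> k0 \<Longrightarrow> h \<ge> 0 \<Longrightarrow>
         card {p \<in> P k. \<bar>shifted_frac \<gamma> p - t\<bar> < h} \<le> 512 * real l * (h * 4 ^ k + 1)"
    using good unfolding good_def by blast+
  define E where "E n = (\<Union>k\<in>{k0 + n..}. \<Union>p\<in>P k. ball (shifted_frac \<gamma> p) (c k / 4 ^ k))" for n
  have inE: "\<exists>k p. k0 + n \<le> k \<and> fst p \<in> T k \<and> u \<le> shifted_frac \<gamma> p \<and> shifted_frac \<gamma> p \<le> v \<and>
      \<bar>\<alpha> - shifted_frac \<gamma> p\<bar> < c k / 4 ^ k" if "\<alpha> \<in> E n" for \<alpha> n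
  proof -
    obtain k p where kp: "k0 + n \<le> k" "p \<in> P k" "\<alpha> \<in> ball (shifted_frac \<gamma> p) (c k / 4 ^ k)"
      using \<open>\<alpha> \<in> E n\<close> by (auto simp: E_def)
    moreover have "p \<in> frac_set \<gamma> u v (T k)" using P(1)[of k] kp by auto
    ultimately show ?thesis
      by (intro exI[of _ k] exI[of _ p]) (auto simp: frac_set_def dist_real_def abs_minus_commute)
  qed
  \<comment> \<open>Balls of level k \<ge> n reach at most 4^-n beyond {u..v}. This gives
    boundedness of \<open>E n\<close> and, in the limit,
    \<open>A \<subseteq> {u..v}\<close>.\<close>
  have close: "c k / 4 ^ k \<le> 1 / 4 ^ n" if "n \<le> k" for k n
    using c that by (intro frac_le power_increasing) auto
  have E: "E n \<in> lmeasurable" for n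
  proof (rule lmeasurable_open)
    have "E n \<subseteq> {u - 1..v + 1}"
    proof
      fix \<alpha> assume "\<alpha> \<in> E n"
      from inE[OF this] obtain k p where "u \<le> shifted_frac \<gamma> p" "shifted_frac \<gamma> p \<le> v"
        "\<bar>\<alpha> - shifted_frac \<gamma> p\<bar> < c k / 4 ^ k" by blast
      moreover have "c k / 4 ^ k \<le> 1" using order_trans[OF close[of 0 k], of 1] by (simp del: divide_le_eq_1)
      ultimately show "\<alpha> \<in> {u - 1..v + 1}" unfolding atLeastAtMost_iff by linarith
    qed
    then show "bounded (E n)" using bounded_subset bounded_closed_interval by blast
  qed (auto simp: E_def)
  define A where "A = (\<Inter>n. E n)"
  have "decseq E" unfolding E_def decseq_def by fastforce
  have lim: "(\<lambda>n. measure lebesgue (E n)) \<longlonglongrightarrow> measure lebesgue A"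
    unfolding A_def
  proof (rule Lim_measure_decseq)
    show "range E \<subseteq> sets lebesgue" using E by (auto intro: fmeasurableD)
    show "emeasure lebesgue (E n) \<noteq> \<infinity>" for n
      unfolding infinity_ennreal_def by (rule fmeasurableD2[OF E])
  qed fact
  have ge: "\<kappa> * (v - u) \<le> measure lebesgue (E n)" for n
  proof -
    have "\<not> summable (\<lambda>i. c (i + (k0 + n)))" using c(3) summable_iff_shift by blast
    \<comment> \<open>Nonnegative terms with partial sums bounded by 1 would be summable, so a
      finite stretch of the tail has weight above 1.\<close>
    then have "\<not> (\<forall>m. (\<Sum>i<m. c (i + (k0 + n))) \<le> 1)"
      using bounded_imp_summable[of "\<lambda>i. c (i + (k0 + n))" 1] c(1)
      by (metis lessThan_Suc_atMost)
    then obtain m where "\<not> (\<Sum>i<m. c (i + (k0 + n))) \<le> 1" by blast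
    then have m: "1 \<le> (\<Sum>i<m. c (i + (k0 + n)))" by simp
    have "(\<Sum>i<m. c (i + (k0 + n))) = (\<Sum>k\<in>{k0 + n..<m + (k0 + n)}. c k)"
      using sum.shift_bounds_nat_ivl[of c 0 "k0 + n" m] by (simp add: atLeast0LessThan)
    with m have sum1: "1 \<le> (\<Sum>k\<in>{k0 + n..<m + (k0 + n)}. c k)" by simp
    \<comment> \<open>Here 1/(4l), 3 and 512 l are the lower count, upper count and spread
      constants, with L = v - u.\<close>
    have "\<kappa> * (v - u) \<le> measure lebesgue
        (\<Union>k\<in>{k0 + n..<m + (k0 + n)}. \<Union>p\<in>P k. ball (shifted_frac \<gamma> p) (c k / 4 ^ k))"
      unfolding \<kappa>_def using l uv P c sum1
      by (intro measure_UN_balls_ge) auto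
    also have "\<dots> \<le> measure lebesgue (E n)"
    proof (rule measure_mono_fmeasurable)
      show "(\<Union>k\<in>{k0 + n..<m + (k0 + n)}. \<Union>p\<in>P k. ball (shifted_frac \<gamma> p) (c k / 4 ^ k)) \<subseteq> E n"
        unfolding E_def by (intro UN_mono) auto
    qed (use E in \<open>auto intro!: borel_open\<close>)
    finally show ?thesis .
  qed
  show ?thesis
  proof
    show "A \<in> lmeasurable" unfolding A_def
      using E by (intro fmeasurable_INT[of UNIV 0]) auto
    show "A \<subseteq> {u..v}"
    proof
      fix \<alpha> assume "\<alpha> \<in> A"
      have "max (u - \<alpha>) (\<alpha> - v) \<le> 1 / 4 ^ n" for n
      proof -
        have "\<alpha> \<in> E n" using \<open>\<alpha> \<in> A\<close> by (auto simp: A_def)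
        from inE[OF this] obtain k p where "k0 + n \<le> k" "u \<le> shifted_frac \<gamma> p" "shifted_frac \<gamma> p \<le> v"
          "\<bar>\<alpha> - shifted_frac \<gamma> p\<bar> < c k / 4 ^ k" by blast
        then show ?thesis using close[of n k] by linarith
      qed
      moreover have "(\<lambda>n. 1 / 4 ^ n :: real) \<longlonglongrightarrow> 0"
        by (rule LIMSEQ_divide_realpow_zero) simp
      ultimately have "max (u - \<alpha>) (\<alpha> - v) \<le> 0" by (intro LIMSEQ_le_const) auto
      then show "\<alpha> \<in> {u..v}" by auto
    qed
    show "infinite {k. \<exists>p. fst p \<in> T k \<and> \<bar>\<alpha> - shifted_frac \<gamma> p\<bar> < c k / 4 ^ k}" if "\<alpha> \<in> A" for \<alpha>
      unfolding infinite_nat_iff_unbounded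
    proof
      fix n
      \<comment> \<open>The successor turns the bound on the level into the strict k > n.\<close>
      have "\<alpha> \<in> E (Suc n)" using that by (auto simp: A_def)
      from inE[OF this] show "\<exists>k>n. k \<in> {k. \<exists>p. fst p \<in> T k \<and> \<bar>\<alpha> - shifted_frac \<gamma> p\<bar> < c k / 4 ^ k}"
        by (metis (mono_tags, lifting) Suc_le_lessD add_leD2 mem_Collect_eq)
    qed
    show "(1 / (4 * real l))\<^sup>2 / (9 * 3 * (512 * real l)) * (v - u) \<le> measure lebesgue A"
      using LIMSEQ_le_const[OF lim] ge unfolding \<kappa>_def by blast
  qed
qed

section \<open>Choice of the class and passage from balls to W\<close>

theorem corollary5:
  fixes \<gamma> :: real
    and P :: "nat set set"
    and \<psi> :: "nat \<Rightarrow> real"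
  assumes "finite P"
    and "partition_on {1..} P"
    and "\<And>q. q \<ge> 1 \<Longrightarrow> 0 \<le> \<psi> q"
    and "\<And>q. q \<ge> 1 \<Longrightarrow> \<psi> (q + 1) \<le> \<psi> q"
    and "(\<Sum>q. ennreal (\<psi> (Suc q))) = \<infinity>"
  shows "\<exists>\<pi>\<in>P. emeasure lebesgue (W (\<lambda>q. indicator \<pi> q * \<psi> q) \<gamma>) = 1"
proof -
  define l where "l = card P"
  define B where "B k = {2 ^ k..<2 * 2 ^ k :: nat}" for k :: nat
  \<comment> \<open>The minimum with 1 secures \<open>c k \<le> 1\<close>. The factor 1/2 pays for q
    < 2 * 2^k: a radius c_k / 4^k around (a + \<gamma>)/q puts q \<alpha> - \<gamma> within 2 c_k /
    2^k \<le> \<psi>(2^(k+1)) \<le> \<psi>(q) of a.\<close>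
  define b where "b k = min 1 (2 ^ k * \<psi> (2 ^ Suc k) / 2)" for k
  have UP: "\<Union>P = {1..}" using assms(2) by (simp add: partition_on_def)
  have l: "l \<ge> 1" using assms(1) UP by (auto simp: l_def Suc_le_eq card_gt_0_iff)
  have b: "0 \<le> b k" "b k \<le> 1" for k
    using assms(3)[of "2 ^ Suc k"] by (auto simp: b_def)
  have "\<not> summable (\<lambda>k. 2 ^ k * \<psi> (2 ^ Suc k))"
    by (intro not_summable_condensed assms(3-5))
  then have "\<not> summable (\<lambda>k. 2 ^ k * \<psi> (2 ^ Suc k) / 2)"
    using summable_mult[of "\<lambda>k. 2 ^ k * \<psi> (2 ^ Suc k) / 2" 2] by auto
  then have "\<not> summable b" unfolding b_def by (intro not_summable_min) auto
  moreover have "\<exists>\<pi>\<in>P. 2 ^ k \<le> l * card (\<pi> \<inter> B k)" for k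
  proof -
    have "B k \<subseteq> \<Union>P" unfolding UP B_def by (auto intro: order_trans[OF one_le_power])
    then show ?thesis
      using ex_class_card_ge[OF assms(1), of "B k"] by (auto simp: B_def l_def)
  qed
  \<comment> \<open>The class is fixed before any interval {u..v} is considered, so one class serves
    all intervals.\<close>
  ultimately obtain \<pi> where \<pi>: "\<pi> \<in> P"
    "\<not> summable (\<lambda>k. if 2 ^ k \<le> l * card (\<pi> \<inter> B k) then b k else 0)"
    using ex_class_not_summable[OF assms(1), of b "\<lambda>\<pi> k. 2 ^ k \<le> l * card (\<pi> \<inter> B k)"] b by auto
  define c where "c k = (if 2 ^ k \<le> l * card (\<pi> \<inter> B k) then b k else 0)" for k
  have c: "0 \<le> c k" "c k \<le> 1" "c k \<le> 2 ^ k * \<psi> (2 ^ Suc k) / 2" for k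
    using b[of k] assms(3)[of "2 ^ Suc k"] by (auto simp: c_def b_def)
  have not_summable: "\<not> summable c" using \<pi>(2) by (simp add: c_def[abs_def])
  have mono: "\<psi> r \<le> \<psi> q" if "1 \<le> q" "q \<le> r" for q r
    using that(2)
  proof (induction rule: dec_induct)
    case (step n)
    then show ?case using assms(4)[of n] that(1) by simp
  qed simp
  define V where "V = W (\<lambda>q. indicator \<pi> q * \<psi> q) \<gamma>"
  have inV: "\<alpha> \<in> V" if \<alpha>: "\<alpha> \<in> {0..1}"
    and inf: "infinite {k. \<exists>p. fst p \<in> \<pi> \<inter> B k \<and> \<bar>\<alpha> - shifted_frac \<gamma> p\<bar> < c k / 4 ^ k}" for \<alpha>
  proof -
    have "\<exists>q>n. q \<in> {q \<in> {1..}. nearest_int_dist (real q * \<alpha> - \<gamma>) < indicator \<pi> q * \<psi> q}" for n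
    proof -
      obtain k q a where k: "n < k" and q: "q \<in> \<pi>" "2 ^ k \<le> q" "q < 2 * 2 ^ k"
        and near: "\<bar>\<alpha> - shifted_frac \<gamma> (q, a)\<bar> < c k / 4 ^ k"
        using inf unfolding infinite_nat_iff_unbounded B_def by fastforce
      have "1 \<le> q" using q(2) by (meson one_le_numeral one_le_power order_trans)
      \<comment> \<open>Since k < 2^k \<le> q, infinitely many levels k produce infinitely many
        q.\<close>
      have "k < q" using q(2) by (meson less_exp less_le_trans)
      have "real q * \<alpha> - \<gamma> - of_int a = real q * (\<alpha> - shifted_frac \<gamma> (q, a))"
        using \<open>1 \<le> q\<close> by (simp add: shifted_frac_def right_diff_distrib)
      then have "nearest_int_dist (real q * \<alpha> - \<gamma>) \<le> real q * \<bar>\<alpha> - shifted_frac \<gamma> (q, a)\<bar>"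
        using nearest_int_dist_le[of "real q * \<alpha> - \<gamma>" a] by (simp add: abs_mult)
      also have "\<dots> < real q * (c k / 4 ^ k)"
        using near \<open>1 \<le> q\<close> by (intro mult_strict_left_mono) auto
      also have "\<dots> \<le> (2 * 2 ^ k) * (c k / 4 ^ k)"
      proof (rule mult_right_mono)
        have "real q \<le> real (2 * 2 ^ k)" using q(3) by (simp only: of_nat_le_iff)
        then show "real q \<le> 2 * 2 ^ k" by simp
      qed (use c in auto)
      also have "\<dots> = 2 * c k / 2 ^ k"
        by (simp add: field_simps power_mult_distrib [symmetric])
      also have "\<dots> \<le> \<psi> (2 ^ Suc k)" using c(3)[of k] by (simp add: field_simps)
      also have "\<dots> \<le> \<psi> q" using q \<open>1 \<le> q\<close> by (intro mono) auto
      finally show ?thesis using q(1) \<open>1 \<le> q\<close> \<open>k < q\<close> k by (intro exI[of _ q]) auto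
    qed
    then show ?thesis using \<alpha> unfolding V_def W_def infinite_nat_iff_unbounded by blast
  qed
  have "emeasure lebesgue V = 1"
  proof (rule emeasure_eq_1_of_locally_positive)
    show V: "V \<in> sets lebesgue" unfolding V_def by (rule W_in_sets_lebesgue)
    show "V \<subseteq> {0..1}" by (auto simp: V_def W_def)
    show "0 < (1 / (4 * real l))\<^sup>2 / (9 * 3 * (512 * real l))" using l by simp
    fix u v :: real
    assume uv: "0 \<le> u" "u < v" "v \<le> 1"
    have T: "\<pi> \<inter> B k \<subseteq> {2 ^ k..<2 * 2 ^ k}" "c k > 0 \<Longrightarrow> 2 ^ k \<le> l * card (\<pi> \<inter> B k)" for k
      by (auto simp: B_def c_def split: if_splits)
    obtain A where A: "A \<in> lmeasurable" "A \<subseteq> {u..v}"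
      "\<And>\<alpha>. \<alpha> \<in> A \<Longrightarrow> infinite {k. \<exists>p. fst p \<in> \<pi> \<inter> B k \<and> \<bar>\<alpha> - shifted_frac \<gamma> p\<bar> < c k / 4 ^ k}"
      "(1 / (4 * real l))\<^sup>2 / (9 * 3 * (512 * real l)) * (v - u) \<le> measure lebesgue A"
      by (rule local_measure_limsup_balls[OF l c(1,2) not_summable T uv(2), where \<gamma> = \<gamma>])
         (assumption, rule that)
    have "A \<subseteq> V \<inter> {u..v}" using A(2,3) inV uv by fastforce
    moreover have "V \<inter> {u..v} \<in> lmeasurable"
      using V by (intro bounded_set_imp_lmeasurable) (auto intro: bounded_subset[of "{u..v}"])
    ultimately have "measure lebesgue A \<le> measure lebesgue (V \<inter> {u..v})"
      using A(1) by (intro measure_mono_fmeasurable) auto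
    with A(4) show "(1 / (4 * real l))\<^sup>2 / (9 * 3 * (512 * real l)) * (v - u)
        \<le> measure lebesgue (V \<inter> {u..v})" by linarith
  qed
  with \<pi>(1) show ?thesis by (auto simp: V_def)
qed

end
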